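(* Consider a double round-robin tournament with four teams, under the rules given in the context, where the tie-breaking rule is either goal difference or head-to-head results. If a team has played at most three matches, then its final position in the group ranking cannot be determined. That is, whatever the results of the matches played so far, the final position of the team is not the same for all possible results of the matches still to be played.
   Context: Double round-robin tournament with four teams: each team plays each of the other three teams exactly twice (once at home, once away). The tournament consists of six rounds (Matchdays 1 to 6); in each round two matches are played so that every team plays exactly one match. The two matches of a round are played simultaneously, so after a given round exactly the results of the matches of that round and all previous rounds are known. Schedule assumption: a team can play its second match against another team only after it has played once against all other teams (so Matchdays 1-3 form a single round-robin, and so do Matchdays 4-6). Match results: the result of a match is a pair of non-negative integers (goals scored by the two teams), without an upper bound. A win is worth 3 points, a draw 1 point, a loss 0 points. Ranking: teams are ranked by total number of points. Ties in points are broken either by goal difference (total goals scored minus total goals conceded in all group matches, higher is better), or by head-to-head results/records (higher number of points obtained in the matches played among the tied teams, followed by superior goal difference in the matches played among the tied teams). The final ranking is the one after all six rounds. The final position of a team is determined (guaranteed) at a given time if it is the same for all possible results of the matches still to be played. *)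

theory Defs
  imports "HOL-Library.Cardinality"
begin

text \<open>
  A match is an ordered pair of distinct teams (home, away), so every pair of teams automatically
  meets exactly twice, once at the ground of each. A schedule \<open>s\<close> assigns to the match of \<open>h\<close>
  (home) against \<open>a\<close> (away) its matchday \<open>s h a\<close>; the values \<open>s h h\<close> are meaningless and are never
  used.
\<close>

type_synonym 'team schedule = "'team \<Rightarrow> 'team \<Rightarrow> nat"

definition matches_of :: "'team \<Rightarrow> ('team \<times> 'team) set" where
  "matches_of t = {(h, a). h \<noteq> a \<and> (h = t \<or> a = t)}"

text \<open>
  The last conjunct says that the second match of \<open>t\<close> against \<open>u\<close> comes after the first match of
  \<open>t\<close> against every team \<open>v\<close>.
\<close>

definition valid_schedule :: "'team schedule \<Rightarrow> bool" where
  "valid_schedule s \<longleftrightarrow>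
     (\<forall>h a. h \<noteq> a \<longrightarrow> s h a \<in> {1..6}) \<and>
     (\<forall>t. \<forall>d\<in>{1..6}. \<exists>!m. m \<in> matches_of t \<and> s (fst m) (snd m) = d) \<and>
     (\<forall>t u v. u \<noteq> t \<and> v \<noteq> t \<longrightarrow> min (s t v) (s v t) < max (s t u) (s u t))"

definition matches_played :: "'team schedule \<Rightarrow> nat \<Rightarrow> 'team \<Rightarrow> nat" where
  "matches_played s k t = card {m \<in> matches_of t. s (fst m) (snd m) \<le> k}"

text \<open>
  \<open>res h a\<close> is the pair (goals of \<open>h\<close>, goals of \<open>a\<close>) in the match played at the ground of \<open>h\<close>.
\<close>

type_synonym 'team results = "'team \<Rightarrow> 'team \<Rightarrow> nat \<times> nat"

definition match_points :: "nat \<Rightarrow> nat \<Rightarrow> nat" where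
  "match_points scored conceded =
     (if scored > conceded then 3 else if scored = conceded then 1 else 0)"

definition points_among :: "'team results \<Rightarrow> 'team set \<Rightarrow> 'team \<Rightarrow> nat" where
  "points_among res S t =
     (\<Sum>u\<in>S - {t}. match_points (fst (res t u)) (snd (res t u)) +
                   match_points (snd (res u t)) (fst (res u t)))"

definition goal_difference_among :: "'team results \<Rightarrow> 'team set \<Rightarrow> 'team \<Rightarrow> int" where
  "goal_difference_among res S t =
     (\<Sum>u\<in>S - {t}. (int (fst (res t u)) - int (snd (res t u))) +
                   (int (snd (res u t)) - int (fst (res u t))))"

abbreviation points :: "'team results \<Rightarrow> 'team \<Rightarrow> nat" where
  "points res \<equiv> points_among res UNIV"

definition tied_with :: "'team results \<Rightarrow> 'team \<Rightarrow> 'team set" where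
  "tied_with res t = {u. points res u = points res t}"

datatype tie_breaking = Goal_Difference | Head_To_Head

fun wins_tie :: "tie_breaking \<Rightarrow> 'team results \<Rightarrow> 'team \<Rightarrow> 'team \<Rightarrow> bool" where
  "wins_tie Goal_Difference res t u \<longleftrightarrow>
     goal_difference_among res UNIV t > goal_difference_among res UNIV u"
| "wins_tie Head_To_Head res t u \<longleftrightarrow>
     points_among res (tied_with res t) t > points_among res (tied_with res t) u \<or>
     points_among res (tied_with res t) t = points_among res (tied_with res t) u \<and>
     goal_difference_among res (tied_with res t) t > goal_difference_among res (tied_with res t) u"

definition ahead :: "tie_breaking \<Rightarrow> 'team results \<Rightarrow> 'team \<Rightarrow> 'team \<Rightarrow> bool" where
  "ahead tb res t u \<longleftrightarrow>
     points res t > points res u \<or> points res t = points res u \<and> wins_tie tb res t u"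

text \<open>
  The criteria above need not separate all teams. A ranking is therefore any total preorder, where
  \<open>(t, u)\<close> means that \<open>t\<close> is ranked at least as high as \<open>u\<close>, that respects them. This covers both
  leaving the remaining teams at a shared position and separating them by further criteria or by
  lots. A ranking rule chooses one such ranking for every complete list of results.
\<close>

definition is_ranking :: "tie_breaking \<Rightarrow> 'team results \<Rightarrow> 'team rel \<Rightarrow> bool" where
  "is_ranking tb res r \<longleftrightarrow>
     preorder_on UNIV r \<and> total r \<and> (\<forall>t u. ahead tb res t u \<longrightarrow> (t, u) \<in> r \<and> (u, t) \<notin> r)"

definition ranking_rule :: "tie_breaking \<Rightarrow> ('team results \<Rightarrow> 'team rel) \<Rightarrow> bool" where
  "ranking_rule tb R \<longleftrightarrow> (\<forall>res. is_ranking tb res (R res))"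

definition position :: "'team rel \<Rightarrow> 'team \<Rightarrow> nat" where
  "position r t = card {u. (u, t) \<in> r \<and> (t, u) \<notin> r} + 1"

text \<open>
  \<open>res'\<close> agrees with \<open>res\<close> except possibly in the matches still to be played after matchday \<open>k\<close>.
\<close>

definition possible_final_results ::
    "'team schedule \<Rightarrow> nat \<Rightarrow> 'team results \<Rightarrow> 'team results \<Rightarrow> bool" where
  "possible_final_results s k res res' \<longleftrightarrow>
     (\<forall>h a. \<not> (h \<noteq> a \<and> s h a > k) \<longrightarrow> res' h a = res h a)"

definition position_determined ::
    "('team results \<Rightarrow> 'team rel) \<Rightarrow> 'team schedule \<Rightarrow> nat \<Rightarrow> 'team results \<Rightarrow> 'team \<Rightarrow> bool" where
  "position_determined R s k res t \<longleftrightarrow>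
     (\<exists>p. \<forall>res'. possible_final_results s k res res' \<longrightarrow> position (R res') t = p)"

end

theory Submission
  imports Defs
begin

text \<open>
  After at most three matchdays every pair of teams still has its second match to play. Hence any
  team \<open>c\<close> can still finish alone at the top: let \<open>c\<close> win its three second matches by a large margin
  and let every other second match reverse the score of the corresponding first match. Then, inside
  every set \<open>S\<close> of teams that contains \<open>c\<close>, the team \<open>c\<close> collects at least \<open>3 (|S| - 1)\<close> points and
  has positive goal difference, whereas each other team collects at most \<open>3 (|S| - 1)\<close> points and
  has negative goal difference. Taking \<open>c = t\<close> and \<open>c \<noteq> t\<close> gives two different positions of \<open>t\<close>.
\<close>

lemma match_points_le: "match_points a b \<le> 3"
  by (simp add: match_points_def)

lemma match_points_reversed_le: "match_points a b + match_points b a \<le> 3"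
  by (simp add: match_points_def)

lemma valid_schedule_unique_day:
  assumes "valid_schedule s" "m \<in> matches_of t" "m' \<in> matches_of t"
    and "s (fst m) (snd m) = s (fst m') (snd m')"
  shows "m = m'"
proof -
  have "s (fst m) (snd m) \<in> {1..6}"
    using assms(1,2) by (auto simp: valid_schedule_def matches_of_def)
  then have "\<exists>!n. n \<in> matches_of t \<and> s (fst n) (snd n) = s (fst m) (snd m)"
    using assms(1) unfolding valid_schedule_def by blast
  then show ?thesis
    using assms(2-4) by metis
qed

lemma valid_schedule_legs_differ:
  assumes "valid_schedule s" "a \<noteq> b"
  shows "s a b \<noteq> s b a"
  using valid_schedule_unique_day[OF assms(1), of "(a, b)" a "(b, a)"] assms(2)
  by (auto simp: matches_of_def)

text \<open>Each of the matchdays 1 to \<open>k\<close> contributes a match of \<open>t\<close>.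
  This turns a bound on matches played into a bound on \<open>k\<close>.\<close>

lemma matches_played_ge:
  fixes s :: "'team::finite schedule"
  assumes "valid_schedule s" "k \<le> 6"
  shows "k \<le> matches_played s k t"
proof -
  let ?day = "\<lambda>m. s (fst m) (snd m)"
  have "{1..k} \<subseteq> ?day ` {m \<in> matches_of t. ?day m \<le> k}"
  proof
    fix d assume d: "d \<in> {1..k}"
    then have "d \<in> {1..6}" using assms(2) by auto
    then obtain m where "m \<in> matches_of t" "?day m = d"
      using assms(1) unfolding valid_schedule_def by blast
    then show "d \<in> ?day ` {m \<in> matches_of t. ?day m \<le> k}"
      using d by auto
  qed
  then have "card {1..k} \<le> card {m \<in> matches_of t. ?day m \<le> k}"
    by (rule surj_card_le[rotated]) simp
  then show ?thesis by (simp add: matches_played_def)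
qed

lemma matches_played_mono:
  fixes s :: "'team::finite schedule"
  assumes "k \<le> l"
  shows "matches_played s k t \<le> matches_played s l t"
  unfolding matches_played_def by (rule card_mono) (use assms in auto)

text \<open>The first legs of \<open>a\<close> against its \<open>CARD('team) - 1\<close> opponents
  fall on distinct days, since two matches of \<open>a\<close> on one day coincide. By the schedule
  assumption all these days precede the second leg against \<open>b\<close>.\<close>

lemma second_leg_day_ge_card:
  fixes s :: "'team::finite schedule"
  assumes "valid_schedule s" "a \<noteq> b"
  shows "CARD('team) \<le> max (s a b) (s b a)"
proof -
  let ?first = "\<lambda>v. min (s a v) (s v a)"
  have "inj_on ?first (- {a})"
  proof (rule inj_onI)
    fix v w assume vw: "v \<in> - {a}" "w \<in> - {a}" "?first v = ?first w"
    have "\<exists>m \<in> {(a, v), (v, a)}. s (fst m) (snd m) = ?first v" for v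
      by (auto simp: min_def)
    then obtain m n where m: "m \<in> {(a, v), (v, a)}" "s (fst m) (snd m) = ?first v"
      and n: "n \<in> {(a, w), (w, a)}" "s (fst n) (snd n) = ?first w"
      by meson
    have "m = n"
      using vw m n by (intro valid_schedule_unique_day[OF assms(1), of m a n])
        (auto simp: matches_of_def)
    then show "v = w" using m n vw by auto
  qed
  moreover have "?first ` (- {a}) \<subseteq> {1..<max (s a b) (s b a)}"
  proof (rule image_subsetI)
    fix v assume "v \<in> - {a}"
    then have "v \<noteq> a" by simp
    then have "s a v \<in> {1..6}" "s v a \<in> {1..6}"
      using assms(1) unfolding valid_schedule_def by (metis (lifting))+
    moreover have "?first v < max (s a b) (s b a)"
      using assms \<open>v \<noteq> a\<close> unfolding valid_schedule_def by (metis (lifting))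
    ultimately show "?first v \<in> {1..<max (s a b) (s b a)}" by auto
  qed
  ultimately have "card (- {a}) \<le> card {1..<max (s a b) (s b a)}"
    by (rule card_inj_on_le) simp
  moreover have "card (- {a}) = CARD('team) - 1" by (simp add: Compl_eq_Diff_UNIV)
  moreover have "s a b \<ge> 1" using assms by (auto simp: valid_schedule_def)
  ultimately show ?thesis by simp
qed

text \<open>
  Scores are seen from the side of the first argument, so that they are swapped when that team plays
  away.
\<close>

definition first_leg :: "'team schedule \<Rightarrow> 'team results \<Rightarrow> 'team results" where
  "first_leg s res a b = (if s a b < s b a then res a b else prod.swap (res b a))"

text \<open>The guard selects the match at the ground of \<open>h\<close> when it is the later of
  the two. Only the home side's view of \<open>g\<close> is read, so \<open>g\<close> has to be
  compatible with swapping for the away side to see the same match.\<close>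

definition set_second_leg ::
    "'team schedule \<Rightarrow> 'team results \<Rightarrow> 'team results \<Rightarrow> 'team results" where
  "set_second_leg s res g h a = (if h \<noteq> a \<and> s a h < s h a then g h a else res h a)"

lemma first_leg_swap:
  assumes "valid_schedule s" "a \<noteq> b"
  shows "first_leg s res b a = prod.swap (first_leg s res a b)"
  using valid_schedule_legs_differ[OF assms] by (auto simp: first_leg_def)

text \<open>For each opponent, the home and away summands are the first and second leg in one order
  or the other; swapping turns the away score into the view of \<open>a\<close>.\<close>

lemma
  assumes s: "valid_schedule s"
    and g: "\<forall>a b. a \<noteq> b \<longrightarrow> g b a = prod.swap (g a b)"
  shows points_among_set_second_leg:
      "points_among (set_second_leg s res g) S a =
        (\<Sum>b\<in>S - {a}. match_points (fst (first_leg s res a b)) (snd (first_leg s res a b)) +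
                       match_points (fst (g a b)) (snd (g a b)))" (is ?points)
    and goal_difference_among_set_second_leg:
      "goal_difference_among (set_second_leg s res g) S a =
        (\<Sum>b\<in>S - {a}. (int (fst (first_leg s res a b)) - int (snd (first_leg s res a b))) +
                       (int (fst (g a b)) - int (snd (g a b))))" (is ?goals)
proof -
  have *: "s a b < s b a \<or> s b a < s a b" "g b a = prod.swap (g a b)" if "b \<in> S - {a}" for b
    using valid_schedule_legs_differ[OF s, of a b] g that by auto
  show ?points ?goals
    unfolding points_among_def goal_difference_among_def
    by (intro sum.cong refl, frule *(1), frule *(2), auto simp: set_second_leg_def first_leg_def)+
qed

lemma possible_final_results_set_second_leg:
  assumes "\<forall>a b. a \<noteq> b \<longrightarrow> k < max (s a b) (s b a)"
  shows "possible_final_results s k res (set_second_leg s res g)"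
  using assms by (fastforce simp: possible_final_results_def set_second_leg_def max_def)

text \<open>
  Head-to-head results compare teams within the set of tied teams, which depends on all results.
  Dominance within every set of teams makes it unnecessary to know this set.
\<close>

lemma ahead_if_dominates:
  assumes points: "\<And>S. t \<in> S \<Longrightarrow> u \<in> S \<Longrightarrow> points_among res S u \<le> points_among res S t"
    and goals: "\<And>S. t \<in> S \<Longrightarrow> u \<in> S \<Longrightarrow>
        goal_difference_among res S u < goal_difference_among res S t"
  shows "ahead tb res t u"
proof (cases "points res t = points res u")
  case True
  then have "t \<in> tied_with res t" "u \<in> tied_with res t" by (simp_all add: tied_with_def)
  then have "wins_tie tb res t u"
    using points[of "tied_with res t"] goals[of "tied_with res t"] goals[of UNIV]
    by (cases tb) auto
  then show ?thesis using True by (simp add: ahead_def)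
next
  case False
  then show ?thesis using points[of UNIV] by (simp add: ahead_def)
qed

lemma can_finish_ahead_of_all:
  fixes s :: "'team::finite schedule"
  assumes s: "valid_schedule s"
    and open_legs: "\<forall>a b. a \<noteq> b \<longrightarrow> k < max (s a b) (s b a)"
  shows "\<exists>res'. possible_final_results s k res res' \<and> (\<forall>u. u \<noteq> c \<longrightarrow> ahead tb res' c u)"
proof -
  let ?F = "first_leg s res"
  \<comment> \<open>\<open>M\<close> exceeds the goals in any single first leg of \<open>c\<close>,
    hence any margin to be made up; \<open>Suc\<close> keeps it positive even if all of these were
    goalless.\<close>
  define M where "M = Suc (\<Sum>u\<in>UNIV. fst (?F c u) + snd (?F c u))"
  define g where "g a b = (if a = c then (M, 0) else if b = c then (0, M) else ?F b a)" for a b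
  let ?res' = "set_second_leg s res g"
  have g_swap: "\<forall>a b. a \<noteq> b \<longrightarrow> g b a = prod.swap (g a b)"
  proof (intro allI impI)
    fix a b :: 'team assume "a \<noteq> b"
    then show "g b a = prod.swap (g a b)"
      using first_leg_swap[OF s, of a b res] by (auto simp: g_def)
  qed
  have M: "fst (?F c u) + snd (?F c u) < M" for u
    unfolding M_def less_Suc_eq_le
    by (rule member_le_sum[where f = "\<lambda>u. fst (?F c u) + snd (?F c u)"]) auto
  note points = points_among_set_second_leg[OF s g_swap]
  note goals = goal_difference_among_set_second_leg[OF s g_swap]
  have "ahead tb ?res' c u" if u: "u \<noteq> c" for u
  proof (rule ahead_if_dominates)
    fix S assume S: "c \<in> S" "u \<in> S"
    have card: "card (S - {u}) = card (S - {c})" using S by simp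
    have "points_among ?res' S u \<le> (\<Sum>b\<in>S - {u}. 3)"
      unfolding points
    proof (rule sum_mono)
      \<comment> \<open>Against \<open>c\<close> the second leg yields 0 points and the first at
        most 3; against any other team a score and its reverse yield at most 3 together.\<close>
      fix b assume "b \<in> S - {u}"
      then show "match_points (fst (?F u b)) (snd (?F u b)) +
          match_points (fst (g u b)) (snd (g u b)) \<le> 3"
        using u first_leg_swap[OF s, of u b res] M[of u] match_points_le
        by (auto simp: g_def match_points_reversed_le match_points_def)
    qed
    also have "\<dots> = (\<Sum>b\<in>S - {c}. 3)" by (simp only: sum_constant card)
    also have "\<dots> \<le> points_among ?res' S c"
      unfolding points by (intro sum_mono) (simp add: g_def match_points_def M_def)
    finally show "points_among ?res' S u \<le> points_among ?res' S c" .
    \<comment> \<open>The opponent \<open>c\<close> is split off because the two legs against every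
      other team cancel, leaving a deficit caused by \<open>M\<close>.\<close>
    have "goal_difference_among ?res' S u =
        (int (fst (?F u c)) - int (snd (?F u c))) + (0 - int M) +
        (\<Sum>b\<in>S - {u} - {c}. (int (fst (?F u b)) - int (snd (?F u b))) +
          (int (fst (g u b)) - int (snd (g u b))))"
      unfolding goals using S u by (subst sum.remove[of _ c]) (auto simp: g_def)
    also have "(\<Sum>b\<in>S - {u} - {c}. (int (fst (?F u b)) - int (snd (?F u b))) +
          (int (fst (g u b)) - int (snd (g u b)))) = 0"
      using u by (intro sum.neutral ballI) (auto simp: g_def first_leg_swap[OF s, of u])
    also have "(int (fst (?F u c)) - int (snd (?F u c))) + (0 - int M) + 0 < 0"
      using M[of u] first_leg_swap[OF s, of c u res] u by auto
    also have "0 < goal_difference_among ?res' S c"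
      unfolding goals
    proof (rule sum_pos)
      show "S - {c} \<noteq> {}" using S u by auto
      show "0 < (int (fst (?F c b)) - int (snd (?F c b))) + (int (fst (g c b)) - int (snd (g c b)))"
        for b using M[of b] by (simp add: g_def)
    qed simp
    finally show "goal_difference_among ?res' S u < goal_difference_among ?res' S c" .
  qed
  then show ?thesis
    using possible_final_results_set_second_leg[OF open_legs] by blast
qed

theorem proposition3p1:
  fixes s :: "'team::finite schedule"
    and tb :: tie_breaking
    and R :: "'team results \<Rightarrow> 'team rel"
    and k :: nat
    and res :: "'team results"
    and t :: 'team
  assumes "CARD('team) = 4"
    and "valid_schedule s"
    and "ranking_rule tb R"
    and "matches_played s k t \<le> 3"
  shows "\<not> position_determined R s k res t"
proof
  assume "position_determined R s k res t"
  then obtain p where p: "\<And>res'. possible_final_results s k res res' \<Longrightarrow> position (R res') t = p"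
    unfolding position_determined_def by blast
  have R: "(a, b) \<in> R res' \<and> (b, a) \<notin> R res'" if "ahead tb res' a b" for res' a b
    using assms(3) that unfolding ranking_rule_def is_ranking_def by blast
  \<comment> \<open>Four matches are already played by matchday 4; monotonicity carries this to
    every later \<open>k\<close>, including values beyond 6.\<close>
  have "\<not> 4 \<le> k"
    using matches_played_ge[OF assms(2), of 4 t] matches_played_mono[of 4 k s t] assms(4) by auto
  then have open_legs: "\<forall>a b. a \<noteq> b \<longrightarrow> k < max (s a b) (s b a)"
    using second_leg_day_ge_card[OF assms(2)] assms(1) by (metis not_less order_trans)
  note can_finish = can_finish_ahead_of_all[OF assms(2) open_legs, of res _ tb]
  have "card (UNIV - {t}) \<noteq> 0" using assms(1) by simp
  then obtain c where "c \<in> UNIV - {t}" by (metis card.empty ex_in_conv)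
  then have c: "c \<noteq> t" by simp
  obtain res1 where res1: "possible_final_results s k res res1" "\<And>u. u \<noteq> t \<Longrightarrow> ahead tb res1 t u"
    using can_finish by blast
  \<comment> \<open>The case \<open>u = t\<close> is trivial; every other team is strictly below
    \<open>t\<close>, whatever ranking \<open>R\<close> chooses.\<close>
  have "(t, u) \<in> R res1" if "(u, t) \<in> R res1" for u
    using R[OF res1(2)[of u]] that by (cases "u = t") simp_all
  then have "{u. (u, t) \<in> R res1 \<and> (t, u) \<notin> R res1} = {}" by blast
  then have "position (R res1) t = 1" by (simp only: position_def card.empty)
  moreover obtain res2 where res2: "possible_final_results s k res res2" "ahead tb res2 c t"
    using can_finish c by metis
  have "c \<in> {u. (u, t) \<in> R res2 \<and> (t, u) \<notin> R res2}" using R res2(2) by blast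
  \<comment> \<open>Position 1 would mean that no team is strictly above \<open>t\<close>, but
    \<open>c\<close> is.\<close>
  then have "position (R res2) t \<noteq> 1" unfolding position_def by (auto simp: card_eq_0_iff)
  ultimately show False using p[OF res1(1)] p[OF res2(1)] by simp
qed

end
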